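(* Let $\alpha\in\mathbb{C}$ with $|\alpha|\le 1$, $\alpha\ne -1$. Suppose that $\phi$ and $\omega$ are Schwarz functions, that $\phi$ is an inner function, and that $\psi=\frac{1+\alpha\omega}{1-\omega}$. Then $C_{\psi,\phi}$ preserves the class $\mathcal{P}_\alpha$ if and only if $\psi\equiv 1$ (i.e., $\omega\equiv 0$).
   Context: $\mathbb{D}=\{z\in\mathbb{C}:|z|<1\}$ and $\mathcal{H}(\mathbb{D})$ is the set of analytic functions on $\mathbb{D}$. A Schwarz function is an analytic function $\omega:\mathbb{D}\to\mathbb{D}$ with $\omega(0)=0$. An analytic function $f$ on $\mathbb{D}$ is inner if $|f(z)|\le1$ for all $z\in\mathbb{D}$ and its radial limits satisfy $|f(\zeta)|=1$ for almost every $\zeta$ with $|\zeta|=1$. For $f,g\in\mathcal{H}(\mathbb{D})$, $f\prec g$ means $f=g\circ\omega$ for some Schwarz function $\omega$. For $|\alpha|\le1$, $\alpha\neq-1$, put $h_\alpha(z)=\frac{1+\alpha z}{1-z}$ and $\mathcal{P}_\alpha=\{f\in\mathcal{H}(\mathbb{D}): f\prec h_\alpha\}$. For $\psi\in\mathcal{H}(\mathbb{D})$ and an analytic self-map $\phi$ of $\mathbb{D}$, $C_{\psi,\phi}(f)=\psi\,(f\circ\phi)$ for $f\in\mathcal{H}(\mathbb{D})$. It preserves $\mathcal{P}_\alpha$ if $C_{\psi,\phi}(\mathcal{P}_\alpha)\subset\mathcal{P}_\alpha$. *)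

theory Defs
  imports "HOL-Complex_Analysis.Complex_Analysis"
begin

text \<open>
  Functions analytic on the open unit disc are total functions that are
  \<open>holomorphic_on\<close> it; all notions below depend only on their values in the disc.
\<close>

abbreviation unit_disc :: "complex set" (\<open>\<bbbD>\<close>) where
  "\<bbbD> \<equiv> ball 0 1"

definition schwarz_function :: "(complex \<Rightarrow> complex) \<Rightarrow> bool" where
  "schwarz_function \<omega> \<longleftrightarrow> \<omega> holomorphic_on \<bbbD> \<and> \<omega> ` \<bbbD> \<subseteq> \<bbbD> \<and> \<omega> 0 = 0"

text \<open>
  Boundary points are written as \<open>cis t\<close>; null sets of the circle correspond to
  Lebesgue null sets of angles \<open>t\<close> in \<open>[0, 2\<pi>)\<close>. Existence of the radial limit almost
  everywhere is automatic for bounded analytic functions (Fatou), so requiring it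
  inside the almost-everywhere quantifier adds nothing.
\<close>

definition inner_function :: "(complex \<Rightarrow> complex) \<Rightarrow> bool" where
  "inner_function f \<longleftrightarrow>
     f holomorphic_on \<bbbD> \<and> (\<forall>z\<in>\<bbbD>. cmod (f z) \<le> 1) \<and>
     (AE t in lebesgue_on {0..<2 * pi}.
        \<exists>l. ((\<lambda>r. f (complex_of_real r * cis t)) \<longlongrightarrow> l) (at_left 1) \<and> cmod l = 1)"

definition subordinate :: "(complex \<Rightarrow> complex) \<Rightarrow> (complex \<Rightarrow> complex) \<Rightarrow> bool"
    (infix \<open>\<prec>\<^sub>s\<close> 50) where
  "f \<prec>\<^sub>s g \<longleftrightarrow> (\<exists>\<omega>. schwarz_function \<omega> \<and> (\<forall>z\<in>\<bbbD>. f z = g (\<omega> z)))"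

definition h_fun :: "complex \<Rightarrow> complex \<Rightarrow> complex" where
  "h_fun \<alpha> z = (1 + \<alpha> * z) / (1 - z)"

definition P_class :: "complex \<Rightarrow> (complex \<Rightarrow> complex) set" where
  "P_class \<alpha> = {f. f holomorphic_on \<bbbD> \<and> f \<prec>\<^sub>s h_fun \<alpha>}"

definition weighted_comp ::
  "(complex \<Rightarrow> complex) \<Rightarrow> (complex \<Rightarrow> complex) \<Rightarrow> (complex \<Rightarrow> complex) \<Rightarrow> complex \<Rightarrow> complex" where
  "weighted_comp \<psi> \<phi> f = (\<lambda>z. \<psi> z * f (\<phi> z))"

definition preserves_P_class ::
  "complex \<Rightarrow> (complex \<Rightarrow> complex) \<Rightarrow> (complex \<Rightarrow> complex) \<Rightarrow> bool" where
  "preserves_P_class \<alpha> \<psi> \<phi> \<longleftrightarrow> weighted_comp \<psi> \<phi> ` P_class \<alpha> \<subseteq> P_class \<alpha>"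

end

theory Submission
  imports Defs
begin

text \<open>
  Testing the operator on the dilations \<open>z \<mapsto> h_fun \<alpha> (c * z)\<close>, \<open>\<bar>c\<bar> \<le> 1\<close>, shows that \<open>\<psi> z\<close>
  maps the disc \<open>h_fun \<alpha> ` cball 0 \<bar>\<phi> z\<bar>\<close> into the half-plane \<open>h_fun \<alpha> ` \<bbbD>\<close>. As
  \<open>\<bar>\<phi> z\<bar> \<rightarrow> 1\<close> this disc exhausts the half-plane, which only positive factors can preserve;
  quantitatively, \<open>cos (arg (\<psi> z)) \<rightarrow> 1\<close>. The function \<open>\<psi>\<close> has a holomorphic logarithm \<open>G\<close>
  with \<open>\<bar>Im G\<bar> < \<pi>\<close>, so \<open>Im G\<close> has radial limit \<open>0\<close> almost everywhere, and no
  boundary values of \<open>\<psi>\<close> itself are needed. Then \<open>exp (\<i> * G)\<close> is bounded, has boundary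
  modulus \<open>1\<close> almost everywhere and equals \<open>1\<close> at the origin, hence it is constant.
\<close>

section \<open>Integrals over circles and uniqueness from unimodular boundary values\<close>

lemma circle_mean_value:
  fixes F :: "complex \<Rightarrow> complex"
  assumes "F holomorphic_on \<bbbD>" "0 < r" "r < 1"
  shows "((\<lambda>t. F (of_real r * cis t)) has_integral 2 * pi * F 0) {0..2 * pi}"
proof -
  have "F holomorphic_on cball 0 r"
    using assms by (intro holomorphic_on_subset[OF assms(1)]) auto
  then have "((\<lambda>u. F u / (u - 0)) has_contour_integral (2 * of_real pi * \<i> * F 0)) (circlepath 0 r)"
    by (rule Cauchy_integral_circlepath_simple) (use assms in auto)
  then have "((\<lambda>t. \<i> * F (of_real r * cis t)) has_integral (2 * of_real pi * \<i> * F 0)) {0..2 * pi}"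
    using \<open>0 < r\<close>
    by (simp add: circlepath_def has_contour_integral_part_circlepath_iff field_simps)
  from has_integral_mult_right[OF this, of "-\<i>"] show ?thesis
    by (simp add: algebra_simps)
qed

text \<open>On the circle of radius \<open>r\<close> the Cauchy kernel has modulus at most
  \<open>1 / (r - cmod z)\<close>, so a small integral of \<open>cmod k\<close> over it forces
  \<open>k z\<close> to be small.\<close>

lemma Cauchy_circle_bound:
  assumes hol: "k holomorphic_on \<bbbD>" and z: "cmod z < r" and r: "0 < r" "r < 1"
  shows "2 * pi * cmod (k z) * (r - cmod z)
           \<le> r * integral {0..2 * pi} (\<lambda>t. cmod (k (of_real r * cis t)))"
proof -
  let ?g = "\<lambda>t. k (of_real r * cis t) / (of_real r * cis t - z) * of_real r * \<i> * cis t"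
  have "k holomorphic_on cball 0 r"
    using r by (intro holomorphic_on_subset[OF hol]) auto
  then have "((\<lambda>u. k u / (u - z)) has_contour_integral (2 * of_real pi * \<i> * k z)) (circlepath 0 r)"
    by (rule Cauchy_integral_circlepath_simple) (use z in auto)
  then have *: "(?g has_integral (2 * of_real pi * \<i> * k z)) {0..2 * pi}"
    by (simp add: circlepath_def has_contour_integral_part_circlepath_iff)
  have cont: "continuous_on {0..2 * pi} (\<lambda>t. cmod (k (of_real r * cis t)))"
    using r
    by (intro continuous_intros continuous_on_compose2[OF holomorphic_on_imp_continuous_on[OF hol]])
       (auto simp: norm_mult)
  have "cmod (integral {0..2 * pi} ?g)
          \<le> integral {0..2 * pi} (\<lambda>t. r / (r - cmod z) * cmod (k (of_real r * cis t)))"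
  proof (rule integral_norm_bound_integral)
    show "?g integrable_on {0..2 * pi}" using * by blast
    show "(\<lambda>t. r / (r - cmod z) * cmod (k (of_real r * cis t))) integrable_on {0..2 * pi}"
      by (intro integrable_continuous_real continuous_intros cont)
    fix t
    have "r - cmod z \<le> cmod (of_real r * cis t - z)"
      using norm_triangle_ineq2[of "of_real r * cis t" z] r by (simp add: norm_mult)
    then show "cmod (?g t) \<le> r / (r - cmod z) * cmod (k (of_real r * cis t))"
      using z r by (simp add: norm_mult norm_divide mult.commute mult_left_mono frac_le)
  qed
  also have "\<dots> = r / (r - cmod z) * integral {0..2 * pi} (\<lambda>t. cmod (k (of_real r * cis t)))"
    by simp
  finally show ?thesis
    using z integral_unique[OF *] by (simp add: norm_mult field_simps)
qed

text \<open>Only the endpoint \<open>b\<close>, a null set, is added. Radial limits are stated on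
  the half-open interval, while the circle integrals run over the closed one.\<close>

lemma AE_lebesgue_on_Ico_Icc:
  assumes "AE t in lebesgue_on {a..<b::real}. P t"
  shows "AE t in lebesgue_on {a..b}. P t"
proof -
  have "AE t in lebesgue. t \<in> {a..<b} \<longrightarrow> P t"
    using assms by (subst (asm) AE_restrict_space_iff) auto
  moreover have "AE t in lebesgue. t \<noteq> b"
    using AE_lborel_singleton[of b] by (simp add: AE_completion)
  ultimately have "AE t in lebesgue. t \<in> {a..b} \<longrightarrow> P t"
    by eventually_elim auto
  then show ?thesis
    by (subst AE_restrict_space_iff) auto
qed

text \<open>
  Since \<open>F 0 = 1\<close>, the mean of \<open>\<bar>F - 1\<bar>\<^sup>2\<close> over a circle is the mean of
  \<open>\<bar>F\<bar>\<^sup>2\<close> minus \<open>1\<close>; it tends to \<open>0\<close> and controls \<open>(F - 1)\<^sup>2\<close> inside by Cauchy's formula.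
\<close>

lemma bounded_unimodular_boundary_eq_1:
  assumes hol: "F holomorphic_on \<bbbD>" and bound: "\<And>z. z \<in> \<bbbD> \<Longrightarrow> cmod (F z) \<le> B"
    and F0: "F 0 = 1"
    and lim: "AE t in lebesgue_on {0..<2 * pi}.
                ((\<lambda>r. cmod (F (of_real r * cis t))) \<longlongrightarrow> 1) (at_left 1)"
    and z: "z \<in> \<bbbD>"
  shows "F z = 1"
proof -
  \<comment> \<open>Dominated convergence is applied along a sequence of radii; the shift by 2 keeps
    \<open>r 0\<close> positive.\<close>
  define r :: "nat \<Rightarrow> real" where "r n = 1 - 1 / (real n + 2)" for n
  have r: "0 < r n" "r n < 1" for n by (auto simp: r_def field_simps)
  have r_lim: "r \<longlonglongrightarrow> 1" unfolding r_def by real_asymp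
  have r_left: "filterlim r (at_left 1) sequentially"
    using r_lim by (simp add: filterlim_at r less_imp_neq[OF r(2)])
  define J where "J n = integral {0..2 * pi} (\<lambda>t. (cmod (F (of_real (r n) * cis t)))\<^sup>2)" for n
  have cont: "continuous_on {0..2 * pi} (\<lambda>t. F (of_real (r n) * cis t))" for n
    using r[of n]
    by (intro continuous_intros continuous_on_compose2[OF holomorphic_on_imp_continuous_on[OF hol]])
       (auto simp: norm_mult)
  have "0 \<le> B" using bound[of 0] F0 by simp
  have "(\<lambda>n. integral\<^sup>L (lebesgue_on {0..2 * pi}) (\<lambda>t. (cmod (F (of_real (r n) * cis t)))\<^sup>2))
          \<longlonglongrightarrow> integral\<^sup>L (lebesgue_on {0..2 * pi}) (\<lambda>t. 1 :: real)"
  proof (rule integral_dominated_convergence[where w = "\<lambda>_. B\<^sup>2"])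
    show "(\<lambda>t. (cmod (F (of_real (r n) * cis t)))\<^sup>2) \<in> borel_measurable (lebesgue_on {0..2 * pi})" for n
      by (intro continuous_imp_measurable_on_sets_lebesgue continuous_intros cont) auto
    show "integrable (lebesgue_on {0..2 * pi}) (\<lambda>_. B\<^sup>2)"
      by (intro continuous_imp_integrable_real continuous_intros)
    show "AE t in lebesgue_on {0..2 * pi}. (\<lambda>n. (cmod (F (of_real (r n) * cis t)))\<^sup>2) \<longlonglongrightarrow> 1"
      using AE_lebesgue_on_Ico_Icc[OF lim]
    proof eventually_elim
      case (elim t)
      then have "(\<lambda>n. cmod (F (of_real (r n) * cis t))) \<longlonglongrightarrow> 1"
        by (rule filterlim_compose[OF _ r_left])
      then show ?case using tendsto_power[of _ 1 _ 2] by fastforce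
    qed
    show "AE t in lebesgue_on {0..2 * pi}. norm ((cmod (F (of_real (r n) * cis t)))\<^sup>2) \<le> B\<^sup>2" for n
      using r[of n] \<open>0 \<le> B\<close> by (intro always_eventually) (auto intro!: power_mono bound simp: norm_mult)
  qed auto
  moreover have "integral\<^sup>L (lebesgue_on {0..2 * pi}) (\<lambda>t. (cmod (F (of_real (r n) * cis t)))\<^sup>2) = J n" for n
    unfolding J_def
    by (intro lebesgue_integral_eq_integral continuous_imp_integrable_real continuous_intros cont) auto
  ultimately have J_lim: "J \<longlonglongrightarrow> 2 * pi"
    by (simp add: measure_restrict_space)
  \<comment> \<open>Expand the square: the mean value property makes \<open>2 * Re F\<close>
    integrate to \<open>4 * pi\<close> and the constant 1 contributes \<open>2 * pi\<close>.\<close>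
  have J: "integral {0..2 * pi} (\<lambda>t. cmod ((F (of_real (r n) * cis t) - 1)\<^sup>2)) = J n - 2 * pi" for n
  proof -
    have "((\<lambda>t. Re (F (of_real (r n) * cis t))) has_integral Re (2 * pi * F 0)) {0..2 * pi}"
      by (intro has_integral_Re circle_mean_value hol r)
    moreover have "((\<lambda>t. (cmod (F (of_real (r n) * cis t)))\<^sup>2) has_integral J n) {0..2 * pi}"
      unfolding J_def
      by (intro integrable_integral integrable_continuous_real continuous_intros cont)
    moreover have "((\<lambda>t. 1 :: real) has_integral 2 * pi) {0..2 * pi}"
      using has_integral_const_real[of "1::real" 0 "2 * pi"] by simp
    ultimately have "((\<lambda>t. (cmod (F (of_real (r n) * cis t)))\<^sup>2 - 2 * Re (F (of_real (r n) * cis t)) + 1)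
        has_integral (J n - 2 * Re (2 * pi * F 0) + 2 * pi)) {0..2 * pi}"
      by (intro has_integral_add has_integral_diff has_integral_mult_right)
    moreover have "(cmod w)\<^sup>2 - 2 * Re w + 1 = cmod ((w - 1)\<^sup>2)" for w
      unfolding norm_power cmod_power2 by (simp add: power2_eq_square algebra_simps)
    ultimately show ?thesis by (simp add: F0 integral_unique)
  qed
  \<comment> \<open>Pass to the limit in the Cauchy bound for the square of \<open>F - 1\<close>,
    valid once \<open>cmod z < r n\<close>. The right-hand side is 0 and \<open>1 - cmod z\<close>
    is positive, so \<open>F z = 1\<close>.\<close>
  have "2 * pi * cmod ((F z - 1)\<^sup>2) * (1 - cmod z) \<le> 1 * (2 * pi - 2 * pi)"
  proof (rule LIMSEQ_le)
    show "(\<lambda>n. 2 * pi * cmod ((F z - 1)\<^sup>2) * (r n - cmod z))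
            \<longlonglongrightarrow> 2 * pi * cmod ((F z - 1)\<^sup>2) * (1 - cmod z)"
      by (intro tendsto_intros r_lim)
    show "(\<lambda>n. r n * (J n - 2 * pi)) \<longlonglongrightarrow> 1 * (2 * pi - 2 * pi)"
      by (intro tendsto_intros r_lim J_lim)
    have "eventually (\<lambda>n. cmod z < r n) sequentially"
      using order_tendstoD(1)[OF r_lim, of "cmod z"] z by simp
    then have "eventually (\<lambda>n. 2 * pi * cmod ((F z - 1)\<^sup>2) * (r n - cmod z)
                 \<le> r n * (J n - 2 * pi)) sequentially"
    proof eventually_elim
      case (elim n)
      have "(\<lambda>w. (F w - 1)\<^sup>2) holomorphic_on \<bbbD>"
        by (intro holomorphic_intros hol)
      from Cauchy_circle_bound[OF this elim r] show ?case by (simp add: J)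
    qed
    then show "\<exists>N. \<forall>n\<ge>N. 2 * pi * cmod ((F z - 1)\<^sup>2) * (r n - cmod z) \<le> r n * (J n - 2 * pi)"
      by (simp add: eventually_sequentially)
  qed
  moreover have "1 - cmod z > 0" using z by simp
  ultimately show ?thesis
    using pi_gt_zero by (auto simp: mult_le_0_iff simp del: pi_gt_zero)
qed

section \<open>The half-plane that is the image of the disc under \<open>h_fun\<close>\<close>

text \<open>Twice \<open>1 - Re u\<close> exceeds the squared modulus of \<open>1 - u\<close> by 1
  minus the squared modulus of \<open>u\<close>.\<close>

lemma Re_inverse_one_minus_gt_half:
  assumes "cmod u < 1"
  shows "Re (1 / (1 - u)) > 1 / 2"
proof -
  have "u \<noteq> 1" using assms by auto
  have "(Re u)\<^sup>2 + (Im u)\<^sup>2 < 1"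
    using assms by (simp add: cmod_def)
  moreover have "(1 - Re u)\<^sup>2 + (Im u)\<^sup>2 > 0"
    using \<open>u \<noteq> 1\<close> by (auto simp: complex_eq_iff sum_power2_gt_zero_iff)
  ultimately show ?thesis
    by (simp add: Re_divide field_simps power2_eq_square)
qed

text \<open>Together with the previous bound this makes
  \<open>1 / (1 - v) - \<alpha> / (1 + \<alpha>)\<close>, which is
  \<open>h_fun \<alpha> v / (1 + \<alpha>)\<close>, have positive real part on the disc.\<close>

lemma Re_divide_one_plus_le_half:
  assumes "cmod \<alpha> \<le> 1" "\<alpha> \<noteq> -1"
  shows "Re (\<alpha> / (1 + \<alpha>)) \<le> 1 / 2"
proof -
  have "(cmod \<alpha>)\<^sup>2 \<le> 1" using assms by (simp add: power_le_one)
  then have "(Re \<alpha>)\<^sup>2 + (Im \<alpha>)\<^sup>2 \<le> 1" by (simp add: cmod_power2)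
  moreover have "(1 + Re \<alpha>)\<^sup>2 + (Im \<alpha>)\<^sup>2 > 0"
    using assms(2) by (auto simp: complex_eq_iff sum_power2_gt_zero_iff add_eq_0_iff)
  ultimately show ?thesis
    by (simp add: Re_divide field_simps power2_eq_square)
qed

lemma h_fun_eq:
  assumes "u \<noteq> 1"
  shows "h_fun \<alpha> u = (1 + \<alpha>) / (1 - u) - \<alpha>"
  using assms by (simp add: h_fun_def field_simps)

text \<open>Dividing \<open>eq\<close> by \<open>1 + \<alpha>\<close> gives
  \<open>a * (1 / (1 - u) - \<kappa>) = 1 / (1 - v) - \<kappa>\<close>, whose right side has
  positive real part; the term \<open>a * \<kappa>\<close> costs at most its modulus.\<close>

lemma h_fun_product_Re_bound:
  assumes \<alpha>: "cmod \<alpha> \<le> 1" "\<alpha> \<noteq> -1" and "cmod u < 1" "cmod v < 1"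
    and eq: "a * h_fun \<alpha> u = h_fun \<alpha> v"
  shows "Re (a / (1 - u)) \<ge> - (cmod a * cmod (\<alpha> / (1 + \<alpha>)))"
proof -
  define \<kappa> where "\<kappa> = \<alpha> / (1 + \<alpha>)"
  have ne: "u \<noteq> 1" "v \<noteq> 1" "1 + \<alpha> \<noteq> 0"
    using assms by (auto simp: add_eq_0_iff)
  have \<alpha>\<kappa>: "\<alpha> = (1 + \<alpha>) * \<kappa>" using ne by (simp add: \<kappa>_def)
  have "a * ((1 + \<alpha>) / (1 - u) - (1 + \<alpha>) * \<kappa>) = (1 + \<alpha>) / (1 - v) - (1 + \<alpha>) * \<kappa>"
    using eq h_fun_eq[OF ne(1)] h_fun_eq[OF ne(2)] \<alpha>\<kappa> by metis
  moreover have "(1 + \<alpha>) * (a / (1 - u) - a * \<kappa>) = a * ((1 + \<alpha>) / (1 - u) - (1 + \<alpha>) * \<kappa>)"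
    "(1 + \<alpha>) * (1 / (1 - v) - \<kappa>) = (1 + \<alpha>) / (1 - v) - (1 + \<alpha>) * \<kappa>"
    by (simp_all add: right_diff_distrib mult.left_commute)
  ultimately have "(1 + \<alpha>) * (a / (1 - u) - a * \<kappa>) = (1 + \<alpha>) * (1 / (1 - v) - \<kappa>)"
    by simp
  then have "a / (1 - u) - a * \<kappa> = 1 / (1 - v) - \<kappa>"
    using ne(3) by (simp only: mult_cancel_left simp_thms)
  then have "a / (1 - u) = 1 / (1 - v) - \<kappa> + a * \<kappa>"
    by (simp only: diff_eq_eq)
  then have "Re (a / (1 - u)) = Re (1 / (1 - v)) - Re \<kappa> + Re (a * \<kappa>)"
    by (metis plus_complex.sel(1) minus_complex.sel(1))
  moreover have "- cmod (a * \<kappa>) \<le> Re (a * \<kappa>)"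
    using abs_Re_le_cmod[of "a * \<kappa>"] by linarith
  ultimately show ?thesis
    using Re_inverse_one_minus_gt_half[OF \<open>cmod v < 1\<close>] Re_divide_one_plus_le_half[OF \<alpha>]
    unfolding \<kappa>_def[symmetric] norm_mult by linarith
qed

section \<open>Dilations as test functions and the lower bound for
  \<open>Re (\<psi> z)\<close>\<close>

lemma h_fun_dilation_in_P_class:
  assumes "cmod c \<le> 1"
  shows "(\<lambda>z. h_fun \<alpha> (c * z)) \<in> P_class \<alpha>"
proof -
  have lt: "cmod (c * z) < 1" if "z \<in> \<bbbD>" for z
    using that assms mult_mono[of "cmod c" 1 "cmod z" "cmod z"] by (auto simp: norm_mult)
  then have "c * z \<noteq> 1" if "z \<in> \<bbbD>" for z
    using that by fastforce
  then have "(\<lambda>z. h_fun \<alpha> (c * z)) holomorphic_on \<bbbD>"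
    unfolding h_fun_def by (intro holomorphic_intros) auto
  moreover have "schwarz_function (\<lambda>z. c * z)"
    using lt by (auto simp: schwarz_function_def intro!: holomorphic_intros)
  ultimately show ?thesis
    by (auto simp: P_class_def subordinate_def)
qed

text \<open>
  The witness \<open>u\<close> makes \<open>1 / (1 - u)\<close> the point of the disc \<open>{1 / (1 - u) | \<bar>u\<bar> \<le> \<rho>}\<close>,
  whose centre is \<open>1 / (1 - \<rho>\<^sup>2)\<close> and radius \<open>\<rho> / (1 - \<rho>\<^sup>2)\<close>, at which \<open>Re (a / (1 - u))\<close> is minimal.
\<close>

lemma preserves_Re_lower_bound:
  assumes \<alpha>: "cmod \<alpha> \<le> 1" "\<alpha> \<noteq> -1" and pres: "preserves_P_class \<alpha> \<psi> \<phi>"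
    and z: "z \<in> \<bbbD>" and \<phi>: "cmod (\<phi> z) < 1" and ne: "\<psi> z \<noteq> 0"
  shows "Re (\<psi> z) \<ge> cmod (\<psi> z) * (cmod (\<phi> z) - cmod (\<alpha> / (1 + \<alpha>)) * (1 - (cmod (\<phi> z))\<^sup>2))"
proof -
  define a \<rho> where "a = \<psi> z" and "\<rho> = cmod (\<phi> z)"
  \<comment> \<open>The direction \<open>s\<close> satisfies \<open>a * s = cmod a\<close>, and
    \<open>u\<close> solves \<open>1 / (1 - u) = (1 - \<rho> * s) / (1 - \<rho>\<^sup>2)\<close>:
    from the centre, go one radius in the direction \<open>- s\<close>.\<close>
  define s where "s = cnj (sgn a)"
  define u where "u = \<rho> * (\<rho> - s) / (1 - \<rho> * s)"
  have \<rho>: "0 \<le> \<rho>" "\<rho> < 1" using \<phi> by (auto simp: \<rho>_def)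
  have "\<rho>\<^sup>2 < 1" using \<rho> by (simp add: power_less_one_iff abs_square_less_1)
  then have \<rho>_ne: "complex_of_real (1 - \<rho>\<^sup>2) \<noteq> 0" by (subst of_real_eq_0_iff) simp
  have "cmod s = 1" using ne by (simp add: s_def a_def norm_sgn)
  have s1: "s * cnj s = 1" using \<open>cmod s = 1\<close> by (simp add: complex_norm_square[symmetric])
  have as: "a * s = cmod a"
    using ne by (simp add: s_def a_def sgn_eq complex_norm_square[symmetric] power2_eq_square)
  have "cmod (\<rho> * s) < 1" using \<open>cmod s = 1\<close> \<rho> by (simp add: norm_mult)
  then have d: "1 - \<rho> * s \<noteq> 0" by (metis eq_iff_diff_eq_0 norm_one order_less_irrefl)
  \<comment> \<open>The disc automorphism \<open>(\<rho> - s) / (1 - \<rho> * s)\<close> is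
    unimodular for \<open>s\<close> on the unit circle, hence
    \<open>cmod u = \<rho>\<close>.\<close>
  have "\<rho> - s = - s * cnj (1 - \<rho> * s)" using s1 by (simp add: algebra_simps)
  then have "cmod (\<rho> - s) = cmod (1 - \<rho> * s)"
    using \<open>cmod s = 1\<close> by (metis complex_mod_cnj mult_1 norm_minus_cancel norm_mult)
  then have u: "cmod u = \<rho>"
    using d \<rho> by (simp add: u_def norm_mult norm_divide)
  then have "u \<noteq> 1" using \<rho> by auto
  have "(1 - u) * (1 - \<rho> * s) = 1 - \<rho>\<^sup>2"
    using d by (simp add: u_def field_simps power2_eq_square)
  then have "1 / (1 - u) = (1 - \<rho> * s) / of_real (1 - \<rho>\<^sup>2)"
    using \<open>u \<noteq> 1\<close> \<rho>_ne by (simp add: nonzero_eq_divide_eq nonzero_divide_eq_eq mult.commute del: of_real_diff)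
  then have "a / (1 - u) = (a - \<rho> * (a * s)) / of_real (1 - \<rho>\<^sup>2)"
    by (metis (no_types, opaque_lifting) mult.left_commute mult.right_neutral right_diff_distrib
        times_divide_eq_right)
  then have key: "Re (a / (1 - u)) = (Re a - \<rho> * cmod a) / (1 - \<rho>\<^sup>2)"
    by (simp add: as Re_divide_of_real del: of_real_diff)
  \<comment> \<open>If \<open>\<phi> z = 0\<close>, then \<open>u = 0\<close>, and division by zero
    gives \<open>c = 0\<close>, so \<open>c * \<phi> z = u\<close> still holds.\<close>
  define c where "c = u / \<phi> z"
  have "cmod c \<le> 1" using u by (simp add: c_def norm_divide \<rho>_def divide_le_eq_1)
  have cu: "c * \<phi> z = u" using u by (auto simp: c_def \<rho>_def)
  have "weighted_comp \<psi> \<phi> (\<lambda>z. h_fun \<alpha> (c * z)) \<in> P_class \<alpha>"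
    using pres h_fun_dilation_in_P_class[OF \<open>cmod c \<le> 1\<close>] by (auto simp: preserves_P_class_def)
  then obtain \<eta> where "schwarz_function \<eta>" "weighted_comp \<psi> \<phi> (\<lambda>z. h_fun \<alpha> (c * z)) z = h_fun \<alpha> (\<eta> z)"
    using z by (auto simp: P_class_def subordinate_def)
  then have "cmod (\<eta> z) < 1" "a * h_fun \<alpha> u = h_fun \<alpha> (\<eta> z)"
    using z cu by (auto simp: weighted_comp_def a_def schwarz_function_def image_subset_iff)
  from h_fun_product_Re_bound[OF \<alpha> _ this] u \<rho>
  have "- (cmod a * cmod (\<alpha> / (1 + \<alpha>))) \<le> (Re a - \<rho> * cmod a) / (1 - \<rho>\<^sup>2)"
    by (simp add: key)
  then show ?thesis
    using \<open>\<rho>\<^sup>2 < 1\<close> unfolding a_def[symmetric] \<rho>_def[symmetric]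
    by (simp add: pos_le_divide_eq algebra_simps)
qed

section \<open>The logarithm of \<open>\<psi>\<close> and its boundary behaviour\<close>

lemma one_plus_in_right_half_plane:
  assumes "cmod w < 1"
  shows "Re (1 + w) > 0"
  using abs_Re_le_cmod[of w] assms by simp

lemma preserves_imp_const:
  assumes \<alpha>: "cmod \<alpha> \<le> 1" "\<alpha> \<noteq> -1"
    and \<phi>: "schwarz_function \<phi>" and \<omega>: "schwarz_function \<omega>" and inner: "inner_function \<phi>"
    and \<psi>: "\<And>z. z \<in> \<bbbD> \<Longrightarrow> \<psi> z = (1 + \<alpha> * \<omega> z) / (1 - \<omega> z)"
    and pres: "preserves_P_class \<alpha> \<psi> \<phi>" and z: "z \<in> \<bbbD>"
  shows "\<psi> z = 1"
proof -
  \<comment> \<open>Numerator and denominator both lie in the right half-plane, so each principal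
    logarithm is holomorphic with imaginary part below \<open>pi / 2\<close> in modulus.\<close>
  define G where "G z = Ln (1 + \<alpha> * \<omega> z) - Ln (1 - \<omega> z)" for z
  define F where "F z = exp (\<i> * G z)" for z
  have hol_\<omega>: "\<omega> holomorphic_on \<bbbD>" using \<omega> by (simp add: schwarz_function_def)
  have \<phi>_lt: "cmod (\<phi> z) < 1" if "z \<in> \<bbbD>" for z
    using \<phi> that by (auto simp: schwarz_function_def image_subset_iff)
  have \<omega>_lt: "cmod (\<omega> z) < 1" if "z \<in> \<bbbD>" for z
    using \<omega> that by (auto simp: schwarz_function_def image_subset_iff)
  then have "cmod (\<alpha> * \<omega> z) < 1" if "z \<in> \<bbbD>" for z
    using that \<alpha>(1) mult_mono[of "cmod \<alpha>" 1 "cmod (\<omega> z)" "cmod (\<omega> z)"]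
    by (fastforce simp: norm_mult)
  then have pos: "Re (1 + \<alpha> * \<omega> z) > 0" "Re (1 - \<omega> z) > 0" if "z \<in> \<bbbD>" for z
    using that one_plus_in_right_half_plane[of "\<alpha> * \<omega> z"] one_plus_in_right_half_plane[of "- \<omega> z"]
      \<omega>_lt[OF that] by auto
  then have ne: "1 + \<alpha> * \<omega> z \<noteq> 0" "1 - \<omega> z \<noteq> 0" if "z \<in> \<bbbD>" for z
    using that by fastforce+
  have hol_G: "G holomorphic_on \<bbbD>"
    unfolding G_def
    by (intro holomorphic_intros hol_\<omega>) (use pos in \<open>fastforce simp: complex_nonpos_Reals_iff\<close>)+
  then have hol_F: "F holomorphic_on \<bbbD>" unfolding F_def by (intro holomorphic_intros)
  have exp_G: "exp (G z) = \<psi> z" if "z \<in> \<bbbD>" for z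
    using that ne by (simp add: G_def exp_diff \<psi>)
  have Im_G: "\<bar>Im (G z)\<bar> \<le> pi" if "z \<in> \<bbbD>" for z
  proof -
    have "\<bar>Im (Ln (1 + \<alpha> * \<omega> z))\<bar> < pi / 2" "\<bar>Im (Ln (1 - \<omega> z))\<bar> < pi / 2"
      using pos[OF that] by (blast intro: Re_Ln_pos_lt_imp)+
    then show ?thesis by (simp add: G_def)
  qed
  have norm_F: "cmod (F z) = exp (- Im (G z))" for z by (simp add: F_def)
  have G0: "G 0 = 0" using \<omega> by (simp add: G_def schwarz_function_def)
  have F_eq: "F w = 1" if w: "w \<in> \<bbbD>" for w
  proof (rule bounded_unimodular_boundary_eq_1[OF hol_F _ _ _ w])
    show "cmod (F z) \<le> exp pi" if "z \<in> \<bbbD>" for z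
      using Im_G[OF that] by (simp add: norm_F)
    show "F 0 = 1" by (simp add: F_def G0)
    have "AE t in lebesgue_on {0..<2 * pi}.
        \<exists>l. ((\<lambda>r. \<phi> (of_real r * cis t)) \<longlongrightarrow> l) (at_left 1) \<and> cmod l = 1"
      using inner by (simp add: inner_function_def)
    then show "AE t in lebesgue_on {0..<2 * pi}.
        ((\<lambda>r. cmod (F (of_real r * cis t))) \<longlongrightarrow> 1) (at_left 1)"
    proof eventually_elim
      case (elim t)
      let ?\<rho> = "\<lambda>r. cmod (\<phi> (of_real r * cis t))"
      let ?\<theta> = "\<lambda>r. Im (G (of_real r * cis t))"
      let ?K = "cmod (\<alpha> / (1 + \<alpha>))"
      have \<rho>: "(?\<rho> \<longlongrightarrow> 1) (at_left 1)"
        using elim tendsto_norm by fastforce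
      have near: "eventually (\<lambda>r. of_real r * cis t \<in> \<bbbD>) (at_left (1::real))"
        using eventually_at_left_real[of 0 "1::real"]
        by (auto elim!: eventually_mono simp: norm_mult)
      \<comment> \<open>As \<open>\<psi> = exp G\<close>, the cosine of \<open>Im G\<close> is
        \<open>Re \<psi> / cmod \<psi>\<close>; dividing the lower bound by
        \<open>cmod \<psi>\<close> squeezes it to 1.\<close>
      have "((\<lambda>r. cos (?\<theta> r)) \<longlongrightarrow> 1) (at_left 1)"
      proof (rule tendsto_sandwich)
        show "((\<lambda>r. ?\<rho> r - ?K * (1 - (?\<rho> r)\<^sup>2)) \<longlongrightarrow> 1) (at_left 1)"
          by (rule tendsto_eq_intros \<rho> refl)+ simp
        show "eventually (\<lambda>r. ?\<rho> r - ?K * (1 - (?\<rho> r)\<^sup>2) \<le> cos (?\<theta> r)) (at_left 1)"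
          using near
        proof eventually_elim
          case (elim r)
          have "\<psi> (of_real r * cis t) \<noteq> 0" using exp_G[OF elim] by (metis exp_not_eq_zero)
          from preserves_Re_lower_bound[where \<phi> = \<phi>, OF \<alpha> pres elim \<phi>_lt[OF elim] this]
          show ?case
            unfolding exp_G[OF elim, symmetric] by (simp add: Re_exp)
        qed
      qed auto
      \<comment> \<open>The bound \<open>pi\<close> on the modulus of \<open>Im G\<close> lets
        \<open>arccos\<close> recover that modulus, excluding limits at other multiples of
        \<open>2 * pi\<close>.\<close>
      then have "((\<lambda>r. arccos (cos (?\<theta> r))) \<longlongrightarrow> arccos 1) (at_left 1)"
        by (rule continuous_on_tendsto_compose[OF continuous_on_arccos']) auto
      moreover have "eventually (\<lambda>r. arccos (cos (?\<theta> r)) = \<bar>?\<theta> r\<bar>) (at_left 1)"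
        using near by eventually_elim (use Im_G arccos_cos_eq_abs in blast)
      ultimately have "((\<lambda>r. \<bar>?\<theta> r\<bar>) \<longlongrightarrow> 0) (at_left 1)"
        by (simp add: tendsto_cong)
      then have "(?\<theta> \<longlongrightarrow> 0) (at_left 1)" by (simp add: tendsto_rabs_zero_iff)
      from tendsto_exp[OF tendsto_minus[OF this]] show ?case by (simp add: norm_F)
    qed
  qed
  \<comment> \<open>\<open>F = 1\<close> alone fixes \<open>G\<close> only up to multiples of
    \<open>2 * pi\<close>; differentiating gives \<open>deriv G = 0\<close>, and
    \<open>G 0 = 0\<close> picks the value.\<close>
  have "G constant_on \<bbbD>"
  proof (rule has_field_derivative_0_imp_constant_on)
    fix w assume w: "w \<in> \<bbbD>"
    have G': "(G has_field_derivative deriv G w) (at w)"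
      using holomorphic_derivI[OF hol_G _ w] by simp
    then have "(F has_field_derivative F w * (\<i> * deriv G w)) (at w)"
      unfolding F_def by (auto intro!: derivative_eq_intros)
    moreover have "(F has_field_derivative 0) (at w)"
      using has_field_derivative_transform_within_open[OF DERIV_const[of 1] open_ball w] F_eq by simp
    ultimately have "F w * (\<i> * deriv G w) = 0" by (rule DERIV_unique)
    then show "(G has_field_derivative 0) (at w)" using G' F_eq[OF w] by simp
  qed auto
  then have "G z = 0" using z G0 by (metis centre_in_ball constant_on_def zero_less_one)
  then show ?thesis using exp_G[OF z] by simp
qed

theorem theorem2:
  fixes \<alpha> :: complex and \<phi> \<omega> \<psi> :: "complex \<Rightarrow> complex"
  assumes "cmod \<alpha> \<le> 1" and "\<alpha> \<noteq> -1"
    and "schwarz_function \<phi>" and "schwarz_function \<omega>"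
    and "inner_function \<phi>"
    and "\<And>z. z \<in> \<bbbD> \<Longrightarrow> \<psi> z = (1 + \<alpha> * \<omega> z) / (1 - \<omega> z)"
  shows "(preserves_P_class \<alpha> \<psi> \<phi> \<longleftrightarrow> (\<forall>z\<in>\<bbbD>. \<psi> z = 1)) \<and>
         ((\<forall>z\<in>\<bbbD>. \<psi> z = 1) \<longleftrightarrow> (\<forall>z\<in>\<bbbD>. \<omega> z = 0))"
proof (intro conjI iffI ballI)
  show "\<psi> z = 1" if "preserves_P_class \<alpha> \<psi> \<phi>" "z \<in> \<bbbD>" for z
    using preserves_imp_const[OF assms that] .
next
  assume \<psi>1: "\<forall>z\<in>\<bbbD>. \<psi> z = 1"
  have \<phi>: "\<phi> holomorphic_on \<bbbD>" "\<phi> ` \<bbbD> \<subseteq> \<bbbD>" "\<phi> 0 = 0"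
    using assms(3) by (auto simp: schwarz_function_def)
  show "preserves_P_class \<alpha> \<psi> \<phi>"
    unfolding preserves_P_class_def
  proof (rule image_subsetI)
    fix f assume "f \<in> P_class \<alpha>"
    then obtain \<eta> where f: "f holomorphic_on \<bbbD>" and \<eta>: "schwarz_function \<eta>"
      and eq: "\<forall>z\<in>\<bbbD>. f z = h_fun \<alpha> (\<eta> z)"
      by (auto simp: P_class_def subordinate_def)
    \<comment> \<open>With \<open>\<psi> = 1\<close> the operator is composition with
      \<open>\<phi>\<close>, and \<open>\<eta> \<circ> \<phi>\<close> is again a Schwarz
      function.\<close>
    have "(f \<circ> \<phi>) holomorphic_on \<bbbD>" "(\<eta> \<circ> \<phi>) holomorphic_on \<bbbD>"
      using \<phi> f \<eta> by (auto simp: schwarz_function_def intro: holomorphic_on_compose_gen)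
    moreover from this(1) have "weighted_comp \<psi> \<phi> f holomorphic_on \<bbbD>"
      by (rule holomorphic_transform) (simp add: weighted_comp_def \<psi>1)
    moreover have "schwarz_function (\<eta> \<circ> \<phi>)"
      using calculation(2) \<phi> \<eta> by (fastforce simp: schwarz_function_def)
    moreover have "\<forall>z\<in>\<bbbD>. weighted_comp \<psi> \<phi> f z = h_fun \<alpha> ((\<eta> \<circ> \<phi>) z)"
      using \<phi> eq \<psi>1 by (auto simp: weighted_comp_def)
    ultimately show "weighted_comp \<psi> \<phi> f \<in> P_class \<alpha>"
      by (auto simp: P_class_def subordinate_def)
  qed
next
  fix z assume "\<forall>z\<in>\<bbbD>. \<psi> z = 1" and z: "z \<in> \<bbbD>"
  then have eq: "(1 + \<alpha> * \<omega> z) / (1 - \<omega> z) = 1" using assms(6) by fastforce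
  \<comment> \<open>The case \<open>\<omega> z = 1\<close> contradicts \<open>eq\<close>, since
    division by zero would yield 0.\<close>
  then have "(1 + \<alpha>) * \<omega> z = 0"
    by (auto simp: field_simps split: if_splits)
  then show "\<omega> z = 0" using assms(2) by (simp add: add_eq_0_iff)
next
  fix z assume "\<forall>z\<in>\<bbbD>. \<omega> z = 0" "z \<in> \<bbbD>"
  then show "\<psi> z = 1" using assms(6) by simp
qed

end
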